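(* Let $n\geq 4$ be an even integer, let $\mathbb{D}_{2n}=\langle a,b \mid a^n=b^2=1,\ ba=a^{n-1}b\rangle$, let $\Psi=\{ab, a^{2}b, \dots , a^{n-1}b, b\}\cup\{a^{n/2}\}$, and let $\Lambda=\mathrm{Cay}(\mathbb{D}_{2n}, \Psi)$. Then the minimum cardinality $\psi(\Lambda)$ of a doubly resolving set of $\Lambda$ is $n$.
   Context: For a finite group $G$ and an inverse-closed subset $Q\subseteq G\setminus\{1\}$, the Cayley graph $\mathrm{Cay}(G,Q)$ has vertex set $G$ and edge set $\{\{x,y\} : x^{-1}y\in Q\}$. In a connected graph $\Gamma$ with distance $d$, vertices $x,y$ doubly resolve vertices $u,v$ if $d(u,x)-d(u,y)\neq d(v,x)-d(v,y)$. A set $S$ of vertices is a doubly resolving set if every two distinct vertices of $\Gamma$ are doubly resolved by some two vertices of $S$; $\psi(\Gamma)$ is the minimum cardinality of a doubly resolving set. *)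

theory Defs
  imports "HOL-Algebra.Group"
begin

text \<open>
  A letter \<open>(g, True)\<close> stands for the generator \<open>g\<close> and \<open>(g, False)\<close> for its formal inverse.
  A relation \<open>u = v\<close> is a pair of words.
\<close>

type_synonym 'g gword = "('g \<times> bool) list"

inductive_set pres_rel :: "('g gword \<times> 'g gword) set \<Rightarrow> ('g gword \<times> 'g gword) set"
  for R :: "('g gword \<times> 'g gword) set" where
  base:   "(u, v) \<in> R \<Longrightarrow> (u, v) \<in> pres_rel R"
| cancel: "([(g, s), (g, \<not> s)], []) \<in> pres_rel R"
| refl:   "(u, u) \<in> pres_rel R"
| sym:    "(u, v) \<in> pres_rel R \<Longrightarrow> (v, u) \<in> pres_rel R"
| trans:  "(u, v) \<in> pres_rel R \<Longrightarrow> (v, w) \<in> pres_rel R \<Longrightarrow> (u, w) \<in> pres_rel R"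
| append: "(u, v) \<in> pres_rel R \<Longrightarrow> (u', v') \<in> pres_rel R \<Longrightarrow> (u @ u', v @ v') \<in> pres_rel R"

definition presented_group :: "('g gword \<times> 'g gword) set \<Rightarrow> 'g gword set monoid" where
  "presented_group R =
     \<lparr> carrier = UNIV // pres_rel R,
       mult = (\<lambda>A B. \<Union>u\<in>A. \<Union>v\<in>B. pres_rel R `` {u @ v}),
       one = pres_rel R `` {[]} \<rparr>"

definition pres_gen :: "('g gword \<times> 'g gword) set \<Rightarrow> 'g \<Rightarrow> 'g gword set" where
  "pres_gen R g = pres_rel R `` {[(g, True)]}"

lemma equiv_pres_rel: "equiv UNIV (pres_rel R)"
  by (intro equivI refl_onI symI transI) (auto intro: pres_rel.intros)

lemma presented_group_mult:
  "pres_rel R `` {u} \<otimes>\<^bsub>presented_group R\<^esub> pres_rel R `` {v} = pres_rel R `` {u @ v}"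
proof -
  have "congruent2 (pres_rel R) (pres_rel R) (\<lambda>u v. pres_rel R `` {u @ v})"
    by (rule congruent2I') (auto intro!: equiv_class_eq[OF equiv_pres_rel] pres_rel.append)
  then show ?thesis
    by (simp add: presented_group_def UN_equiv_class2[OF equiv_pres_rel equiv_pres_rel])
qed

lemma pres_rel_inverse:
  "(rev (map (\<lambda>(g, s). (g, \<not> s)) w) @ w, []) \<in> pres_rel R"
proof (induction w)
  case Nil
  show ?case by (simp add: pres_rel.refl)
next
  case (Cons x w)
  obtain g s where x: "x = (g, s)" by (cases x)
  let ?w' = "rev (map (\<lambda>(g, s). (g, \<not> s)) w)"
  have "([(g, \<not> s), (g, s)], []) \<in> pres_rel R"
    using pres_rel.cancel[of g "\<not> s" R] by simp
  then have "(?w' @ ([(g, \<not> s), (g, s)] @ w), ?w' @ ([] @ w)) \<in> pres_rel R"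
    by (intro pres_rel.append pres_rel.refl)
  with Cons.IH show ?case
    by (auto simp: x intro: pres_rel.trans)
qed

lemma group_presented_group: "group (presented_group R)"
proof (rule groupI)
  have car: "carrier (presented_group R) = UNIV // pres_rel R"
    and one: "\<one>\<^bsub>presented_group R\<^esub> = pres_rel R `` {[]}"
    by (simp_all add: presented_group_def)
  note E = car one presented_group_mult
  show "x \<otimes>\<^bsub>presented_group R\<^esub> y \<in> carrier (presented_group R)"
    if "x \<in> carrier (presented_group R)" "y \<in> carrier (presented_group R)" for x y
    using that unfolding car by (auto elim!: quotientE simp: E intro!: quotientI)
  show "\<one>\<^bsub>presented_group R\<^esub> \<in> carrier (presented_group R)"
    by (simp add: E quotientI)
  show "x \<otimes>\<^bsub>presented_group R\<^esub> y \<otimes>\<^bsub>presented_group R\<^esub> z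
      = x \<otimes>\<^bsub>presented_group R\<^esub> (y \<otimes>\<^bsub>presented_group R\<^esub> z)"
    if "x \<in> carrier (presented_group R)" "y \<in> carrier (presented_group R)"
       "z \<in> carrier (presented_group R)" for x y z
    using that unfolding car by (auto elim!: quotientE simp: E)
  show "\<one>\<^bsub>presented_group R\<^esub> \<otimes>\<^bsub>presented_group R\<^esub> x = x"
    if "x \<in> carrier (presented_group R)" for x
    using that unfolding car by (auto elim!: quotientE simp: E)
  show "\<exists>y\<in>carrier (presented_group R). y \<otimes>\<^bsub>presented_group R\<^esub> x = \<one>\<^bsub>presented_group R\<^esub>"
    if "x \<in> carrier (presented_group R)" for x
  proof -
    from that obtain w where "x = pres_rel R `` {w}"
      unfolding car by (auto elim: quotientE)
    then have "pres_rel R `` {rev (map (\<lambda>(g, s). (g, \<not> s)) w)} \<otimes>\<^bsub>presented_group R\<^esub> x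
        = \<one>\<^bsub>presented_group R\<^esub>"
      by (simp add: E equiv_class_eq[OF equiv_pres_rel pres_rel_inverse])
    then show ?thesis
      by (metis UNIV_I car quotientI)
  qed
qed

datatype dih_gen = GenA | GenB

definition dih_rels :: "nat \<Rightarrow> (dih_gen gword \<times> dih_gen gword) set" where
  "dih_rels n =
     (let a = (GenA, True); b = (GenB, True) in
      {(replicate n a, []), ([b, b], []), ([b, a], replicate (n - 1) a @ [b])})"

text \<open>The group is indexed by \<open>n\<close> and has order \<open>2 * n\<close>.\<close>

definition dihedral :: "nat \<Rightarrow> dih_gen gword set monoid" where
  "dihedral n = presented_group (dih_rels n)"

definition dih_a :: "nat \<Rightarrow> dih_gen gword set" where
  "dih_a n = pres_gen (dih_rels n) GenA"

definition dih_b :: "nat \<Rightarrow> dih_gen gword set" where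
  "dih_b n = pres_gen (dih_rels n) GenB"

definition dih_Psi :: "nat \<Rightarrow> dih_gen gword set set" where
  "dih_Psi n =
     {dih_a n [^]\<^bsub>dihedral n\<^esub> i \<otimes>\<^bsub>dihedral n\<^esub> dih_b n | i. i \<in> {1..n - 1}} \<union> {dih_b n}
     \<union> {dih_a n [^]\<^bsub>dihedral n\<^esub> (n div 2)}"

record 'v ugraph =
  verts :: "'v set"
  edges :: "'v set set"

definition walk :: "'v ugraph \<Rightarrow> 'v list \<Rightarrow> bool" where
  "walk \<Gamma> p \<longleftrightarrow>
     p \<noteq> [] \<and> set p \<subseteq> verts \<Gamma> \<and> successively (\<lambda>x y. {x, y} \<in> edges \<Gamma>) p"

text \<open>
  The distance is meaningful only between vertices joined by a walk, so it is used only for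
  connected graphs. A walk of length \<open>k\<close> has \<open>k + 1\<close> entries.
\<close>

definition gdist :: "'v ugraph \<Rightarrow> 'v \<Rightarrow> 'v \<Rightarrow> nat" where
  "gdist \<Gamma> u v = (LEAST k. \<exists>p. walk \<Gamma> p \<and> hd p = u \<and> last p = v \<and> length p = Suc k)"

definition doubly_resolve :: "'v ugraph \<Rightarrow> 'v \<Rightarrow> 'v \<Rightarrow> 'v \<Rightarrow> 'v \<Rightarrow> bool" where
  "doubly_resolve \<Gamma> x y u v \<longleftrightarrow>
     int (gdist \<Gamma> u x) - int (gdist \<Gamma> u y) \<noteq> int (gdist \<Gamma> v x) - int (gdist \<Gamma> v y)"

definition doubly_resolving_set :: "'v ugraph \<Rightarrow> 'v set \<Rightarrow> bool" where
  "doubly_resolving_set \<Gamma> S \<longleftrightarrow> S \<subseteq> verts \<Gamma> \<and>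
     (\<forall>u\<in>verts \<Gamma>. \<forall>v\<in>verts \<Gamma>. u \<noteq> v \<longrightarrow> (\<exists>x\<in>S. \<exists>y\<in>S. doubly_resolve \<Gamma> x y u v))"

text \<open>Finiteness is required explicitly since \<open>card\<close> is 0 on infinite sets.\<close>

definition psi :: "'v ugraph \<Rightarrow> nat" where
  "psi \<Gamma> = (LEAST k. \<exists>S. finite S \<and> doubly_resolving_set \<Gamma> S \<and> card S = k)"

definition Cayley_graph :: "('a, 'm) monoid_scheme \<Rightarrow> 'a set \<Rightarrow> 'a ugraph" where
  "Cayley_graph G Q =
     \<lparr> verts = carrier G,
       edges = {{x, y} | x y. x \<in> carrier G \<and> y \<in> carrier G \<and> inv\<^bsub>G\<^esub> x \<otimes>\<^bsub>G\<^esub> y \<in> Q} \<rparr>"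

end

theory Submission
  imports Defs "HOL-Algebra.Coset"
begin

text \<open>
  Let \<open>H\<close> be the rotation subgroup and \<open>z = a\<^sup>n\<^sup>/\<^sup>2\<close>. The graph is the join of two perfect
  matchings \<open>x \<leftrightarrow> x z\<close>, one on \<open>H\<close> and one on the reflections, so all distances are at most 2.
  Matched vertices are twins: they are at the same distance from every other vertex, whence a
  doubly resolving set meets each of the \<open>n\<close> matching edges. Conversely, choosing one endpoint of
  every matching edge gives a doubly resolving set, since each side has at least two edges.
\<close>

section \<open>Joins of two perfect matchings\<close>

lemma gdist_le:
  assumes "walk \<Gamma> p" "hd p = u" "last p = v" "length p = Suc k"
  shows "gdist \<Gamma> u v \<le> k"
  unfolding gdist_def by (rule Least_le) (use assms in blast)

text \<open>\<open>gdist\<close> is a \<open>LEAST\<close>, hence attained only once some walk is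
  known to exist; the given walk \<open>p\<close> supplies that witness, whatever its
  length.\<close>

lemma gdist_walk:
  assumes "walk \<Gamma> p" "hd p = u" "last p = v"
  obtains q where "walk \<Gamma> q" "hd q = u" "last q = v" "length q = Suc (gdist \<Gamma> u v)"
proof -
  have "\<exists>q. walk \<Gamma> q \<and> hd q = u \<and> last q = v \<and> length q = Suc (length p - 1)"
    using assms by (intro exI[of _ p]) (auto simp: walk_def)
  from LeastI[of "\<lambda>k. \<exists>q. walk \<Gamma> q \<and> hd q = u \<and> last q = v \<and> length q = Suc k", OF this]
  show thesis using that unfolding gdist_def by blast
qed

lemma gdist_neq_0:
  assumes "walk \<Gamma> p" "hd p = u" "last p = v" "u \<noteq> v"
  shows "gdist \<Gamma> u v \<noteq> 0"
proof
  assume 0: "gdist \<Gamma> u v = 0"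
  obtain q where q: "hd q = u" "last q = v" "length q = Suc (gdist \<Gamma> u v)"
    using gdist_walk[OF assms(1-3)] by blast
  then obtain x where "q = [x]" unfolding 0 by (auto simp: length_Suc_conv)
  then show False using q assms(4) by simp
qed

lemma gdist_self: "u \<in> verts \<Gamma> \<Longrightarrow> gdist \<Gamma> u u = 0"
  using gdist_le[of \<Gamma> "[u]" u u 0] by (simp add: walk_def)

lemma gdist_adjacent:
  assumes "u \<in> verts \<Gamma>" "v \<in> verts \<Gamma>" "u \<noteq> v" "{u, v} \<in> edges \<Gamma>"
  shows "gdist \<Gamma> u v = 1"
proof -
  have w: "walk \<Gamma> [u, v]" using assms by (simp add: walk_def)
  have "gdist \<Gamma> u v \<noteq> 0" using gdist_neq_0[OF w, of u v] assms(3) by simp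
  with gdist_le[OF w, of u v 1] show ?thesis by simp
qed

lemma gdist_common_neighbour:
  assumes "u \<in> verts \<Gamma>" "v \<in> verts \<Gamma>" "u \<noteq> v" "{u, v} \<notin> edges \<Gamma>"
    and "w \<in> verts \<Gamma>" "{u, w} \<in> edges \<Gamma>" "{w, v} \<in> edges \<Gamma>"
  shows "gdist \<Gamma> u v = 2"
proof -
  have w: "walk \<Gamma> [u, w, v]" using assms by (simp add: walk_def)
  obtain q where q: "walk \<Gamma> q" "hd q = u" "last q = v" "length q = Suc (gdist \<Gamma> u v)"
    using gdist_walk[OF w, of u v] by auto
  have "gdist \<Gamma> u v \<noteq> 0" using gdist_neq_0[OF w, of u v] assms(3) by simp
  moreover have "gdist \<Gamma> u v \<noteq> 1" using q assms(4) by (auto simp: length_Suc_conv walk_def)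
  ultimately show ?thesis using gdist_le[OF w, of u v 2] by simp
qed

text \<open>The two values of \<open>side\<close> are the two parts of the join, and the pairs
  \<open>v\<close>, \<open>mate v\<close> are the matching edges. \<open>other_side\<close> supplies
  common neighbours for nonadjacent vertices, and \<open>other_pair\<close> a second matching edge
  on each side.\<close>

locale matching_join =
  fixes \<Gamma> :: "'v ugraph" and side :: "'v \<Rightarrow> bool" and mate :: "'v \<Rightarrow> 'v"
  assumes finite_verts: "finite (verts \<Gamma>)"
    and mate_verts: "v \<in> verts \<Gamma> \<Longrightarrow> mate v \<in> verts \<Gamma>"
    and mate_mate: "v \<in> verts \<Gamma> \<Longrightarrow> mate (mate v) = v"
    and mate_neq: "v \<in> verts \<Gamma> \<Longrightarrow> mate v \<noteq> v"
    and side_mate: "v \<in> verts \<Gamma> \<Longrightarrow> side (mate v) = side v"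
    and edges_iff: "\<lbrakk>u \<in> verts \<Gamma>; v \<in> verts \<Gamma>\<rbrakk> \<Longrightarrow>
      {u, v} \<in> edges \<Gamma> \<longleftrightarrow> side u \<noteq> side v \<or> v = mate u"
    and other_side: "v \<in> verts \<Gamma> \<Longrightarrow> \<exists>w\<in>verts \<Gamma>. side w \<noteq> side v"
    and other_pair: "v \<in> verts \<Gamma> \<Longrightarrow> \<exists>w\<in>verts \<Gamma>. side w = side v \<and> w \<noteq> v \<and> w \<noteq> mate v"
begin

lemma gdist_eq:
  assumes "u \<in> verts \<Gamma>" "v \<in> verts \<Gamma>"
  shows "gdist \<Gamma> u v = (if u = v then 0 else if side u \<noteq> side v \<or> v = mate u then 1 else 2)"
proof -
  obtain w where "w \<in> verts \<Gamma>" "side w \<noteq> side u" using other_side assms by blast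
  then show ?thesis
    using assms by (auto simp: gdist_self edges_iff gdist_adjacent
        intro: gdist_common_neighbour[where w = w])
qed

lemma card_doubly_resolving_ge:
  assumes "doubly_resolving_set \<Gamma> S" "finite S"
  shows "card (verts \<Gamma>) \<le> 2 * card S"
proof -
  have S: "S \<subseteq> verts \<Gamma>" using assms by (simp add: doubly_resolving_set_def)
  have "verts \<Gamma> \<subseteq> S \<union> mate ` S"
  proof (rule ccontr)
    assume "\<not> verts \<Gamma> \<subseteq> S \<union> mate ` S"
    then obtain v where v: "v \<in> verts \<Gamma>" "v \<notin> S" "v \<notin> mate ` S" by blast
    then have m: "mate v \<notin> S" using mate_mate by force
    have "gdist \<Gamma> v x = gdist \<Gamma> (mate v) x" if "x \<in> S" for x
    proof -
      \<comment> \<open>Off the edge of \<open>v\<close>, only the sides matter: both distances are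
        1 if \<open>x\<close> is on the other side and 2 otherwise.\<close>
      have "x \<in> verts \<Gamma>" "x \<noteq> v" "x \<noteq> mate v" using that S v m by auto
      then show ?thesis using v(1) by (auto simp: gdist_eq mate_verts mate_mate side_mate)
    qed
    moreover obtain x y where "x \<in> S" "y \<in> S" "doubly_resolve \<Gamma> x y v (mate v)"
      using assms v(1) mate_verts mate_neq unfolding doubly_resolving_set_def by metis
    ultimately show False by (simp add: doubly_resolve_def)
  qed
  then have "card (verts \<Gamma>) \<le> card (S \<union> mate ` S)" using assms by (intro card_mono) auto
  also have "\<dots> \<le> card S + card (mate ` S)" by (rule card_Un_le)
  also have "\<dots> \<le> 2 * card S" using card_image_le[OF assms(2), of mate] by simp
  finally show ?thesis .
qed

lemma transversal_exists:
  obtains S where "S \<subseteq> verts \<Gamma>" "2 * card S = card (verts \<Gamma>)"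
    "\<forall>v\<in>verts \<Gamma>. v \<in> S \<longleftrightarrow> mate v \<notin> S"
proof -
  \<comment> \<open>The choice is made from the set \<open>{v, mate v}\<close>, which is the same
    set for both ends of a matching edge, so both ends get the same representative.\<close>
  define f where "f v = (SOME x. x \<in> {v, mate v})" for v
  define S where "S = f ` verts \<Gamma>"
  have f_mem: "f v \<in> {v, mate v}" for v unfolding f_def by (rule someI[of _ v]) simp
  have f_mate: "f (mate v) = f v" if "v \<in> verts \<Gamma>" for v
    using that by (simp add: f_def mate_mate disj_commute insert_commute)
  have f_S: "f x = x" if "x \<in> S" for x
    using that f_mem f_mate unfolding S_def by (metis imageE insertE singletonD)
  have S: "S \<subseteq> verts \<Gamma>" unfolding S_def using f_mem mate_verts by (metis image_subsetI insertE singletonD)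
  have iff: "v \<in> S \<longleftrightarrow> mate v \<notin> S" if v: "v \<in> verts \<Gamma>" for v
  proof -
    have "f v \<in> S" using v by (simp add: S_def)
    then have "v \<in> S \<or> mate v \<in> S" using f_mem[of v] by auto
    moreover have "\<not> (v \<in> S \<and> mate v \<in> S)"
      using f_S[of v] f_S[of "mate v"] f_mate[OF v] mate_neq[OF v] by auto
    ultimately show ?thesis by blast
  qed
  have "verts \<Gamma> = S \<union> mate ` S"
  proof
    show "verts \<Gamma> \<subseteq> S \<union> mate ` S" using iff mate_mate by (metis UnCI image_eqI subsetI)
    show "S \<union> mate ` S \<subseteq> verts \<Gamma>" using S mate_verts by blast
  qed
  \<comment> \<open>\<open>S\<close> and its image under \<open>mate\<close> split the vertices into
    two parts of equal size.\<close>
  moreover have "S \<inter> mate ` S = {}" using S iff by blast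
  moreover have "inj_on mate S" using S mate_mate by (metis inj_onI subsetD)
  ultimately have "card (verts \<Gamma>) = card S + card S"
    using finite_verts by (metis card_Un_disjoint card_image finite_Un)
  then show thesis using that[OF S] iff by simp
qed

lemma doubly_resolving_transversal:
  assumes S: "S \<subseteq> verts \<Gamma>" and iff: "\<And>v. v \<in> verts \<Gamma> \<Longrightarrow> v \<in> S \<longleftrightarrow> mate v \<notin> S"
  shows "doubly_resolving_set \<Gamma> S"
  unfolding doubly_resolving_set_def
proof (intro conjI ballI impI)
  fix u v assume uv: "u \<in> verts \<Gamma>" "v \<in> verts \<Gamma>" "u \<noteq> v"
  have rep: "\<exists>x\<in>S. x \<in> verts \<Gamma> \<and> (x = w \<or> x = mate w)" if "w \<in> verts \<Gamma>" for w
    using iff[OF that] that mate_verts by blast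
  obtain x where x: "x \<in> S" "x \<in> verts \<Gamma>" "x = u \<or> x = mate u" using rep uv by blast
  \<comment> \<open>\<open>w\<close> lies on a second matching edge on the side of \<open>u\<close>;
    its representative \<open>y\<close> is then at distance 2 from \<open>u\<close>.\<close>
  obtain w where w: "w \<in> verts \<Gamma>" "side w = side u" "w \<noteq> u" "w \<noteq> mate u"
    using other_pair uv by blast
  obtain y where y: "y \<in> S" "y \<in> verts \<Gamma>" "y = w \<or> y = mate w" using rep w by blast
  have y': "side y = side u" "y \<noteq> u" "y \<noteq> mate u" "u \<noteq> mate y"
    using y w uv(1) side_mate mate_mate by metis+
  obtain y2 where y2: "y2 \<in> S" "y2 \<in> verts \<Gamma>" "y2 = v \<or> y2 = mate v" using rep uv by blast
  show "\<exists>x\<in>S. \<exists>y\<in>S. doubly_resolve \<Gamma> x y u v"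
  proof (cases "side u = side v \<and> v \<noteq> mate u")
    \<comment> \<open>For different edges on one side, use their representatives: the difference of
      distances is negative at \<open>u\<close> and positive at \<open>v\<close>.\<close>
    case True
    moreover have "u \<noteq> mate v" "mate u \<noteq> mate v" "u \<noteq> mate u" "v \<noteq> mate v"
      using True uv mate_mate mate_neq by metis+
    ultimately have "gdist \<Gamma> u x \<le> 1" "gdist \<Gamma> v y2 \<le> 1" "gdist \<Gamma> u y2 = 2" "gdist \<Gamma> v x = 2"
      using x y2 uv by (auto simp: gdist_eq side_mate mate_mate)
    then have "doubly_resolve \<Gamma> x y2 u v" unfolding doubly_resolve_def by linarith
    then show ?thesis using x y2 by blast
  next
    case False
    show ?thesis
    proof (cases "v = mate u")
      \<comment> \<open>For the two ends of one edge, \<open>x\<close> is one of them, at distance 0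
        from itself and 1 from the other, while \<open>y\<close> is at distance 2 from both.\<close>
      case True
      then have "(x = u \<and> x \<noteq> v) \<or> (x = v \<and> x \<noteq> u)" using x uv by auto
      then have "gdist \<Gamma> u x \<noteq> gdist \<Gamma> v x"
        using uv by (auto simp: gdist_eq split: if_splits)
      moreover have "gdist \<Gamma> u y = 2" "gdist \<Gamma> v y = 2"
        using True y y' uv by (auto simp: gdist_eq side_mate mate_mate)
      ultimately have "doubly_resolve \<Gamma> x y u v" unfolding doubly_resolve_def by linarith
      then show ?thesis using x y by blast
    next
      \<comment> \<open>For opposite sides, \<open>x\<close> and \<open>y\<close> both lie on the
        side of \<open>u\<close>: the difference is 0 at \<open>v\<close>, but not at
        \<open>u\<close>.\<close>
      case v: False
      with False have "side x = side u" "side v \<noteq> side u" using x uv side_mate by auto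
      then have "gdist \<Gamma> v x = 1" "gdist \<Gamma> v y = 1" using x y y' uv by (auto simp: gdist_eq)
      moreover have "gdist \<Gamma> u x \<le> 1" "gdist \<Gamma> u y = 2"
        using x y y' uv by (auto simp: gdist_eq)
      ultimately have "doubly_resolve \<Gamma> x y u v" unfolding doubly_resolve_def by linarith
      then show ?thesis using x y by blast
    qed
  qed
qed (rule S)

theorem psi_eq: "2 * psi \<Gamma> = card (verts \<Gamma>)"
proof -
  obtain S where S: "S \<subseteq> verts \<Gamma>" "2 * card S = card (verts \<Gamma>)"
    "\<forall>v\<in>verts \<Gamma>. v \<in> S \<longleftrightarrow> mate v \<notin> S"
    using transversal_exists by blast
  have "psi \<Gamma> = card S"
    unfolding psi_def
  proof (rule Least_equality)
    show "\<exists>T. finite T \<and> doubly_resolving_set \<Gamma> T \<and> card T = card S"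
    proof (intro exI conjI)
      show "finite S" using S(1) finite_verts by (rule finite_subset)
      show "doubly_resolving_set \<Gamma> S" using doubly_resolving_transversal S(1,3) by simp
    qed simp
  next
    fix k assume "\<exists>T. finite T \<and> doubly_resolving_set \<Gamma> T \<and> card T = k"
    then obtain T where "finite T" "doubly_resolving_set \<Gamma> T" "card T = k" by (elim exE conjE)
    then show "card S \<le> k" using card_doubly_resolving_ge[of T] S(2) by linarith
  qed
  then show ?thesis using S(2) by simp
qed

end

section \<open>Cayley graphs over a subgroup of index two\<close>

text \<open>\<open>index2\<close> says that membership in \<open>H\<close> is the kernel condition
  of a homomorphism to a group of order 2. The sides are the two cosets, the mate of
  \<open>x\<close> is \<open>x \<otimes> z\<close>, and \<open>w\<close> provides the second
  matching edge inside each coset.\<close>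

lemma (in group) psi_Cayley_index_two:
  assumes fin: "finite (carrier G)"
    and H: "H \<subseteq> carrier G" "H \<noteq> carrier G"
    and index2: "\<And>x y. \<lbrakk>x \<in> carrier G; y \<in> carrier G\<rbrakk> \<Longrightarrow> x \<otimes> y \<in> H \<longleftrightarrow> (x \<in> H \<longleftrightarrow> y \<in> H)"
    and z: "z \<in> H" "z \<noteq> \<one>" "z \<otimes> z = \<one>"
    and w: "w \<in> H" "w \<noteq> \<one>" "w \<noteq> z"
  shows "2 * psi (Cayley_graph G (carrier G - H \<union> {z})) = order G"
proof -
  define \<Gamma> where "\<Gamma> = Cayley_graph G (carrier G - H \<union> {z})"
  have V: "verts \<Gamma> = carrier G" by (simp add: \<Gamma>_def Cayley_graph_def)
  have zc: "z \<in> carrier G" and wc: "w \<in> carrier G" using z w H by auto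
  \<comment> \<open>\<open>index2\<close> applied to \<open>z \<otimes> \<one>\<close> puts
    \<open>\<one>\<close> into \<open>H\<close>; applied to \<open>inv x \<otimes> x\<close> it then
    gives the claim.\<close>
  have invH: "inv x \<in> H \<longleftrightarrow> x \<in> H" if "x \<in> carrier G" for x
    using index2[of "inv x" x] index2[of x \<one>] that z(1) index2[of z \<one>] zc by auto
  have adj: "inv x \<otimes> y \<in> carrier G - H \<union> {z} \<longleftrightarrow> (x \<in> H) \<noteq> (y \<in> H) \<or> y = x \<otimes> z"
    if "x \<in> carrier G" "y \<in> carrier G" for x y
  proof -
    have "inv x \<otimes> y = z \<longleftrightarrow> y = x \<otimes> z"
      using that zc by (metis inv_solve_left)
    then show ?thesis using that invH index2[of "inv x" y] by auto
  qed
  have zz: "x \<otimes> z \<otimes> z = x" if "x \<in> carrier G" for x using that zc z by (simp add: m_assoc)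
  interpret matching_join \<Gamma> "\<lambda>x. x \<in> H" "\<lambda>x. x \<otimes> z"
  proof
    show "finite (verts \<Gamma>)" using fin V by simp
  next
    fix v assume "v \<in> verts \<Gamma>"
    then have v: "v \<in> carrier G" by (simp add: V)
    show "v \<otimes> z \<in> verts \<Gamma>" using v zc by (simp add: V)
    show "v \<otimes> z \<otimes> z = v" using v by (rule zz)
    show "v \<otimes> z \<noteq> v" using v zc z(2) by simp
    show "(v \<otimes> z \<in> H) = (v \<in> H)" using v zc z(1) index2 by simp
    show "\<exists>w\<in>verts \<Gamma>. (w \<in> H) \<noteq> (v \<in> H)" using H z(1) zc unfolding V by blast
    have "v \<otimes> w \<noteq> v \<otimes> z" "v \<otimes> w \<noteq> v" using v wc zc w by simp_all
    then show "\<exists>w\<in>verts \<Gamma>. (w \<in> H) = (v \<in> H) \<and> w \<noteq> v \<and> w \<noteq> v \<otimes> z"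
      using v wc w(1) index2 unfolding V by (intro bexI[of _ "v \<otimes> w"]) auto
  next
    fix u v assume "u \<in> verts \<Gamma>" "v \<in> verts \<Gamma>"
    then have uv: "u \<in> carrier G" "v \<in> carrier G" by (simp_all add: V)
    \<comment> \<open>An unordered pair can arise in either orientation; the two conditions agree
      because \<open>z\<close> is an involution.\<close>
    have "{u, v} \<in> edges \<Gamma> \<longleftrightarrow> inv u \<otimes> v \<in> carrier G - H \<union> {z} \<or> inv v \<otimes> u \<in> carrier G - H \<union> {z}"
      using uv unfolding \<Gamma>_def Cayley_graph_def by (auto simp: doubleton_eq_iff)
    also have "\<dots> \<longleftrightarrow> (u \<in> H) \<noteq> (v \<in> H) \<or> v = u \<otimes> z"
      using adj[OF uv] adj[OF uv(2,1)] zz uv by metis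
    finally show "{u, v} \<in> edges \<Gamma> \<longleftrightarrow> (u \<in> H) \<noteq> (v \<in> H) \<or> v = u \<otimes> z" .
  qed
  show ?thesis using psi_eq V by (simp add: \<Gamma>_def order_def)
qed

section \<open>Normal forms in the dihedral group\<close>

text \<open>
  A word acts on the integers, \<open>a\<close> as the translation by 1 and \<open>b\<close> as negation; \<open>rot w\<close> is
  the image of 0 and \<open>flips w\<close> tells whether the orientation is reversed.
\<close>

fun flips :: "dih_gen gword \<Rightarrow> bool" where
  "flips [] = False"
| "flips ((GenA, s) # w) = flips w"
| "flips ((GenB, s) # w) = (\<not> flips w)"

fun rot :: "dih_gen gword \<Rightarrow> int" where
  "rot [] = 0"
| "rot ((GenA, s) # w) = (if s then 1 else - 1) + rot w"
| "rot ((GenB, s) # w) = - rot w"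

lemma flips_append: "flips (u @ v) \<longleftrightarrow> flips u \<noteq> flips v"
  by (induction u rule: flips.induct) auto

lemma rot_append: "rot (u @ v) = rot u + (if flips u then - rot v else rot v)"
  by (induction u rule: flips.induct) auto

lemma flips_replicate_A: "\<not> flips (replicate i (GenA, s))"
  by (induction i) auto

lemma rot_replicate_A: "rot (replicate i (GenA, True)) = int i"
  by (induction i) auto

text \<open>The action on the integers respects the relations modulo \<open>n\<close>:
  \<open>a^n\<close> translates by \<open>n\<close>, and \<open>ba\<close> and
  \<open>a^(n-1) b\<close> send 0 to -1 and \<open>n - 1\<close>. With \<open>n \<ge> 1\<close> the
  subtraction in the exponent is not truncated. These invariants later separate the normal
  forms.\<close>

lemma pres_rel_dih_sound:
  assumes "(u, v) \<in> pres_rel (dih_rels n)" "n \<ge> 1"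
  shows "flips u = flips v \<and> int n dvd rot u - rot v"
  using assms(1)
proof induction
  case (base u v)
  then show ?case
    using assms(2)
    by (auto simp: dih_rels_def Let_def flips_append rot_append flips_replicate_A rot_replicate_A)
next
  case (cancel g s)
  then show ?case by (cases g) auto
next
  case (sym u v)
  then show ?case by (simp add: dvd_diff_commute)
next
  case (trans u v w)
  then have "int n dvd (rot u - rot v) + (rot v - rot w)" by (intro dvd_add) auto
  then show ?case using trans by simp
next
  case (append u v u' v')
  \<comment> \<open>The sum occurs when the first words preserve orientation, the difference when
    they reverse it.\<close>
  then have "int n dvd (rot u - rot v) + (rot u' - rot v')"
    "int n dvd (rot u - rot v) - (rot u' - rot v')" by (auto intro: dvd_add dvd_diff)
  then show ?case using append by (auto simp: rot_append flips_append algebra_simps)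
qed simp

section \<open>Group elements as classes of words\<close>

definition dih_class :: "nat \<Rightarrow> dih_gen gword \<Rightarrow> dih_gen gword set" where
  "dih_class n w = pres_rel (dih_rels n) `` {w}"

lemma group_dihedral: "group (dihedral n)"
  unfolding dihedral_def by (rule group_presented_group)

lemma carrier_dihedral: "carrier (dihedral n) = range (dih_class n)"
  by (auto simp: dihedral_def presented_group_def dih_class_def quotient_def)

lemma dih_class_mult: "dih_class n u \<otimes>\<^bsub>dihedral n\<^esub> dih_class n v = dih_class n (u @ v)"
  unfolding dih_class_def dihedral_def by (rule presented_group_mult)

lemma dih_class_Nil: "dih_class n [] = \<one>\<^bsub>dihedral n\<^esub>"
  by (simp add: dih_class_def dihedral_def presented_group_def)

lemma dih_class_eqI: "(u, v) \<in> pres_rel (dih_rels n) \<Longrightarrow> dih_class n u = dih_class n v"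
  unfolding dih_class_def by (rule equiv_class_eq[OF equiv_pres_rel])

lemma dih_class_eqD:
  assumes "dih_class n u = dih_class n v" "n \<ge> 1"
  shows "flips u = flips v" "int n dvd rot u - rot v"
  using pres_rel_dih_sound[of u v n] assms eq_equiv_class[OF _ equiv_pres_rel]
  unfolding dih_class_def by auto

lemma dih_a_class: "dih_a n = dih_class n [(GenA, True)]"
  and dih_b_class: "dih_b n = dih_class n [(GenB, True)]"
  by (simp_all add: dih_a_def dih_b_def pres_gen_def dih_class_def)

lemma dih_class_power_a:
  "dih_class n (replicate i (GenA, True)) = dih_a n [^]\<^bsub>dihedral n\<^esub> i"
proof (induction i)
  case 0
  then show ?case by (simp add: dih_class_Nil)
next
  case (Suc i)
  have "dih_class n (replicate (Suc i) (GenA, True))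
      = dih_class n (replicate i (GenA, True)) \<otimes>\<^bsub>dihedral n\<^esub> dih_a n"
    by (simp only: dih_a_class dih_class_mult replicate_append_same replicate_Suc)
  then show ?case by (simp add: Suc)
qed

lemma dih_relations:
  "dih_a n [^]\<^bsub>dihedral n\<^esub> n = \<one>\<^bsub>dihedral n\<^esub>"
  "dih_b n \<otimes>\<^bsub>dihedral n\<^esub> dih_b n = \<one>\<^bsub>dihedral n\<^esub>"
  "dih_b n \<otimes>\<^bsub>dihedral n\<^esub> dih_a n = dih_a n [^]\<^bsub>dihedral n\<^esub> (n - 1) \<otimes>\<^bsub>dihedral n\<^esub> dih_b n"
  unfolding dih_class_power_a[symmetric] dih_class_Nil[symmetric]
  by (auto simp: dih_a_class dih_b_class dih_class_mult dih_rels_def Let_def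
      intro!: dih_class_eqI pres_rel.base)

definition dih_nf :: "nat \<Rightarrow> nat \<times> bool \<Rightarrow> dih_gen gword set" where
  "dih_nf n = (\<lambda>(i, r). dih_class n (replicate i (GenA, True) @ (if r then [(GenB, True)] else [])))"

lemma dih_nf_eq:
  "dih_nf n (i, False) = dih_a n [^]\<^bsub>dihedral n\<^esub> i"
  "dih_nf n (i, True) = dih_a n [^]\<^bsub>dihedral n\<^esub> i \<otimes>\<^bsub>dihedral n\<^esub> dih_b n"
  by (simp_all add: dih_nf_def dih_b_class dih_class_mult flip: dih_class_power_a)

text \<open>Letters are absorbed one by one from the left, with unbounded exponents that are reduced
  modulo \<open>n\<close> only at the end. Recording \<open>flips w\<close> ties the coset of the
  element to the parity of the word.\<close>

lemma dih_class_normal_form: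
  assumes "n \<ge> 1"
  shows "\<exists>i<n. dih_class n w = dih_nf n (i, flips w)"
proof -
  interpret group "dihedral n" by (rule group_dihedral)
  let ?G = "dihedral n" and ?a = "dih_a n" and ?b = "dih_b n"
  have a: "?a \<in> carrier ?G" and b: "?b \<in> carrier ?G"
    by (auto simp: carrier_dihedral dih_a_class dih_b_class)
  \<comment> \<open>Iterating the third relation moves \<open>b\<close> past a power of
    \<open>a\<close>; the factor \<open>n - 1\<close> stands for -1 modulo \<open>n\<close>.\<close>
  have swap: "?b \<otimes>\<^bsub>?G\<^esub> ?a [^]\<^bsub>?G\<^esub> i = ?a [^]\<^bsub>?G\<^esub> ((n - 1) * i) \<otimes>\<^bsub>?G\<^esub> ?b" for i
  proof (induction i)
    case 0
    show ?case using a b by simp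
  next
    case (Suc i)
    have "?b \<otimes>\<^bsub>?G\<^esub> ?a [^]\<^bsub>?G\<^esub> Suc i = ?a [^]\<^bsub>?G\<^esub> ((n - 1) * i) \<otimes>\<^bsub>?G\<^esub> (?b \<otimes>\<^bsub>?G\<^esub> ?a)"
      using a b Suc by (simp add: m_assoc[symmetric])
    also have "\<dots> = ?a [^]\<^bsub>?G\<^esub> ((n - 1) * i + (n - 1)) \<otimes>\<^bsub>?G\<^esub> ?b"
      using a b by (simp add: dih_relations m_assoc[symmetric] nat_pow_mult)
    finally show ?case by (simp only: mult_Suc_right add.commute)
  qed
  \<comment> \<open>Each formal inverse letter and the proposed positive power are both left
    inverses of the same generator, so right cancellation identifies them.\<close>
  have letter: "dih_class n [(GenA, False)] = ?a [^]\<^bsub>?G\<^esub> (n - 1)"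
    "dih_class n [(GenB, False)] = ?b"
  proof -
    have "dih_class n [(GenA, False)] \<otimes>\<^bsub>?G\<^esub> ?a = \<one>\<^bsub>?G\<^esub>"
      "dih_class n [(GenB, False)] \<otimes>\<^bsub>?G\<^esub> ?b = \<one>\<^bsub>?G\<^esub>"
      using pres_rel.cancel[of _ False "dih_rels n"]
      unfolding dih_class_Nil[symmetric] by (auto simp: dih_a_class dih_b_class dih_class_mult
          intro!: dih_class_eqI)
    moreover have "?a [^]\<^bsub>?G\<^esub> (n - 1) \<otimes>\<^bsub>?G\<^esub> ?a = \<one>\<^bsub>?G\<^esub>"
      using dih_relations(1)[of n] assms by (cases n) auto
    ultimately show "dih_class n [(GenA, False)] = ?a [^]\<^bsub>?G\<^esub> (n - 1)"
      "dih_class n [(GenB, False)] = ?b"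
      using a b dih_relations(2)[of n] right_cancel carrier_dihedral nat_pow_closed
      by (metis rangeI)+
  qed
  have reduce: "?a [^]\<^bsub>?G\<^esub> i = ?a [^]\<^bsub>?G\<^esub> (i mod n)" for i
  proof -
    have "?a [^]\<^bsub>?G\<^esub> i = (?a [^]\<^bsub>?G\<^esub> n) [^]\<^bsub>?G\<^esub> (i div n) \<otimes>\<^bsub>?G\<^esub> ?a [^]\<^bsub>?G\<^esub> (i mod n)"
      using a by (simp add: nat_pow_pow nat_pow_mult)
    then show ?thesis using a by (simp add: dih_relations)
  qed
  have cons: "dih_class n (x # w) = dih_class n [x] \<otimes>\<^bsub>?G\<^esub> dih_class n w" for x w
    by (simp add: dih_class_mult)
  have "\<exists>i. dih_class n w = dih_nf n (i, flips w)"
  proof (induction w rule: flips.induct)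
    case 1
    show ?case using dih_nf_eq(1)[of n 0] by (auto simp: dih_class_Nil)
  next
    case (2 s w)
    then obtain i where i: "dih_class n w = dih_nf n (i, flips w)" by blast
    have "dih_class n [(GenA, s)] = ?a [^]\<^bsub>?G\<^esub> (if s then 1 else n - 1)"
      using a letter by (simp add: dih_a_class)
    then have "dih_class n ((GenA, s) # w) = dih_nf n ((if s then 1 else n - 1) + i, flips w)"
      unfolding cons[of _ w] i using a b
      by (cases "flips w") (simp_all add: dih_nf_eq nat_pow_mult m_assoc[symmetric])
    then show ?case by auto
  next
    case (3 s w)
    then obtain i where i: "dih_class n w = dih_nf n (i, flips w)" by blast
    have "dih_class n [(GenB, s)] = ?b"
      using letter by (cases s) (simp_all add: dih_b_class)
    moreover have "?b \<otimes>\<^bsub>?G\<^esub> dih_nf n (i, flips w) = dih_nf n ((n - 1) * i, \<not> flips w)"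
    proof (cases "flips w")
      case True
      have "?b \<otimes>\<^bsub>?G\<^esub> (?a [^]\<^bsub>?G\<^esub> i \<otimes>\<^bsub>?G\<^esub> ?b) = ?a [^]\<^bsub>?G\<^esub> ((n - 1) * i) \<otimes>\<^bsub>?G\<^esub> (?b \<otimes>\<^bsub>?G\<^esub> ?b)"
        using a b swap[of i] by (metis m_assoc nat_pow_closed)
      with True show ?thesis using a b by (simp add: dih_nf_eq dih_relations)
    next
      case False
      then show ?thesis using swap by (simp add: dih_nf_eq)
    qed
    ultimately have "dih_class n ((GenB, s) # w) = dih_nf n ((n - 1) * i, \<not> flips w)"
      unfolding cons[of _ w] i by simp
    then show ?case by auto
  qed
  then obtain i where "dih_class n w = dih_nf n (i, flips w)" by blast
  also have "\<dots> = dih_nf n (i mod n, flips w)"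
    using reduce[of i] by (cases "flips w") (simp_all add: dih_nf_eq)
  finally show ?thesis using assms by (intro exI[of _ "i mod n"]) simp
qed

text \<open>The invariants \<open>flips\<close> and \<open>rot\<close> of the word for
  \<open>(i, r)\<close> are \<open>r\<close> and \<open>i\<close>; the class fixes \<open>i\<close>
  modulo \<open>n\<close>, which is enough for \<open>i < n\<close>.\<close>

lemma inj_on_dih_nf:
  assumes "n \<ge> 1"
  shows "inj_on (dih_nf n) ({..<n} \<times> UNIV)"
proof (rule inj_onI)
  fix p q assume pq: "p \<in> {..<n} \<times> UNIV" "q \<in> {..<n} \<times> UNIV" "dih_nf n p = dih_nf n q"
  obtain i r j s where p: "p = (i, r)" and q: "q = (j, s)" by fastforce
  have ij: "i < n" "j < n" and eq: "dih_nf n (i, r) = dih_nf n (j, s)" using pq p q by auto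
  from dih_class_eqD[OF eq[unfolded dih_nf_def prod.case] assms]
  have "r = s" "int n dvd int i - int j"
    by (auto simp: flips_append rot_append flips_replicate_A rot_replicate_A split: if_splits)
  moreover from this(2) have "int i mod int n = int j mod int n" by (simp only: mod_eq_dvd_iff)
  ultimately show "p = q" using ij p q by simp
qed

lemma carrier_dihedral_nf:
  assumes "n \<ge> 1"
  shows "carrier (dihedral n) = dih_nf n ` ({..<n} \<times> UNIV)"
proof
  show "carrier (dihedral n) \<subseteq> dih_nf n ` ({..<n} \<times> UNIV)"
    using dih_class_normal_form[OF assms] unfolding carrier_dihedral by fastforce
  show "dih_nf n ` ({..<n} \<times> UNIV) \<subseteq> carrier (dihedral n)"
    unfolding carrier_dihedral dih_nf_def by auto
qed

lemma dih_Psi_eq: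
  assumes "n \<ge> 1"
  shows "dih_Psi n = dih_nf n ` ({..<n} \<times> {True}) \<union> {dih_nf n (n div 2, False)}"
proof -
  interpret group "dihedral n" by (rule group_dihedral)
  \<comment> \<open>The separately listed \<open>b\<close> is the reflection with exponent 0,
    completing the range 1 to \<open>n - 1\<close>.\<close>
  have "dih_b n = dih_nf n (0, True)"
    by (simp add: dih_nf_eq carrier_dihedral dih_b_class)
  moreover have "{..<n} = insert 0 {1..n - 1}" using assms by auto
  then have "dih_nf n ` ({..<n} \<times> {True}) = insert (dih_nf n (0, True)) ((\<lambda>i. dih_nf n (i, True)) ` {1..n - 1})"
    by auto
  ultimately show ?thesis
    unfolding dih_Psi_def by (auto simp: dih_nf_eq)
qed

section \<open>The minimum for the dihedral Cayley graph\<close>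

theorem theorem3p6:
  fixes n :: nat
  assumes "n \<ge> 4" and "even n"
  shows "psi (Cayley_graph (dihedral n) (dih_Psi n)) = n"
proof -
  have n: "n \<ge> 1" using assms by simp
  interpret group "dihedral n" by (rule group_dihedral)
  let ?G = "dihedral n"
  define H where "H = dih_nf n ` ({..<n} \<times> {False})"
  define z where "z = dih_nf n (n div 2, False)"
  have inj: "dih_nf n p = dih_nf n q \<longleftrightarrow> p = q"
    if "p \<in> {..<n} \<times> UNIV" "q \<in> {..<n} \<times> UNIV" for p q
    using inj_on_dih_nf[OF n] that by (simp add: inj_on_eq_iff)
  have one: "\<one>\<^bsub>?G\<^esub> = dih_nf n (0, False)" by (simp add: dih_nf_eq)
  \<comment> \<open>Being a rotation is thus a parity of words, and the index-two condition reduces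
    to \<open>flips_append\<close>.\<close>
  have H_iff: "dih_class n u \<in> H \<longleftrightarrow> \<not> flips u" for u
  proof -
    obtain i where "i < n" "dih_class n u = dih_nf n (i, flips u)"
      using dih_class_normal_form[OF n] by blast
    then show ?thesis by (auto simp: H_def inj)
  qed
  have diff: "carrier ?G - H = dih_nf n ` ({..<n} \<times> {True})"
    unfolding carrier_dihedral_nf[OF n] H_def by (auto simp: inj)
  have ord: "order ?G = 2 * n"
    unfolding order_def carrier_dihedral_nf[OF n] card_image[OF inj_on_dih_nf[OF n]]
    by (simp add: card_cartesian_product)
  have "2 * psi (Cayley_graph ?G (carrier ?G - H \<union> {z})) = order ?G"
  \<comment> \<open>The third rotation is \<open>a\<close> itself: \<open>n \<ge> 4\<close> gives
    \<open>n div 2 \<ge> 2\<close>, so \<open>a\<close> differs from both \<open>\<one>\<close> and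
    \<open>z\<close>.\<close>
  proof (rule psi_Cayley_index_two[where w = "dih_nf n (1, False)"])
    show "finite (carrier ?G)" by (simp add: carrier_dihedral_nf[OF n])
    show "H \<subseteq> carrier ?G" unfolding carrier_dihedral_nf[OF n] H_def by auto
    show "H \<noteq> carrier ?G" using diff n lessThan_empty_iff[of n] by auto
    show "x \<otimes>\<^bsub>?G\<^esub> y \<in> H \<longleftrightarrow> (x \<in> H \<longleftrightarrow> y \<in> H)" if "x \<in> carrier ?G" "y \<in> carrier ?G" for x y
      using that unfolding carrier_dihedral by (auto simp: dih_class_mult H_iff flips_append)
    show "z \<in> H" "dih_nf n (1, False) \<in> H" using assms by (auto simp: z_def H_def)
    show "z \<noteq> \<one>\<^bsub>?G\<^esub>" "dih_nf n (1, False) \<noteq> \<one>\<^bsub>?G\<^esub>" "dih_nf n (1, False) \<noteq> z"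
      using assms by (auto simp: one z_def inj)
    have "dih_a n \<in> carrier ?G" by (simp add: carrier_dihedral dih_a_class)
    then have "z \<otimes>\<^bsub>?G\<^esub> z = dih_a n [^]\<^bsub>?G\<^esub> (n div 2 + n div 2)"
      unfolding z_def dih_nf_eq by (rule nat_pow_mult)
    also have "n div 2 + n div 2 = n" using assms by auto
    finally show "z \<otimes>\<^bsub>?G\<^esub> z = \<one>\<^bsub>?G\<^esub>" by (simp add: dih_relations)
  qed
  \<comment> \<open>All reflections together with \<open>z\<close> form exactly
    \<open>dih_Psi n\<close>, and the group has order \<open>2 * n\<close>.\<close>
  then show ?thesis by (simp add: diff dih_Psi_eq[OF n] ord z_def)
qed

end
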